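(* Let $0<\zeta\le 1$, let $(a,b)\subset\mathbb{R}$ be an open interval, and let $\varpi_0,\varpi_1,\varpi_2$ be functions on $(a,b)$ with $\varpi_0(\mu)\neq 0$ and $\varpi_2(\mu)\neq 0$ for all $\mu\in(a,b)$, such that the local fractional derivative $D^{(\zeta)}\varpi_2$ exists on $(a,b)$. Put $$\Omega_1(\mu)=\varpi_2(\mu)\,\varpi_0(\mu),\qquad \Omega_2(\mu)=\varpi_1(\mu)+\frac{D^{(\zeta)}\varpi_2(\mu)}{\varpi_2(\mu)}.$$ Let $\psi$ be a function on $(a,b)$ with $\psi(\mu)\neq 0$ for all $\mu\in(a,b)$, such that $D^{(\zeta)}\psi$ and $D^{(2\zeta)}\psi$ exist on $(a,b)$, and set $$\Phi(\mu)=-\frac{D^{(\zeta)}\psi(\mu)}{\varpi_2(\mu)\,\psi(\mu)},\qquad \mu\in(a,b).$$ Then $\Phi$ satisfies the local fractional nonlinear Riccati differential equation $$D^{(\zeta)}\Phi(\mu)=\varpi_0(\mu)+\varpi_1(\mu)\Phi(\mu)+\varpi_2(\mu)\Phi^2(\mu)\qquad(\mu\in(a,b))$$ if and only if $\psi$ satisfies the local fractional linear ordinary differential equation $$D^{(2\zeta)}\psi(\mu)-\Omega_2(\mu)\,D^{(\zeta)}\psi(\mu)+\Omega_1(\mu)\,\psi(\mu)=0\qquad(\mu\in(a,b)).$$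
   Context: All functions are real- or complex-valued functions on the interval $(a,b)$. For $0<\zeta\le 1$, the local fractional derivative of order $\zeta$ of a function $\Phi$ at $\mu_0\in(a,b)$ is $$D^{(\zeta)}\Phi(\mu_0)=\frac{d^\zeta\Phi(\mu)}{d\mu^\zeta}\Big|_{\mu=\mu_0}=\lim_{\mu\to\mu_0}\frac{\Gamma(1+\zeta)\,[\Phi(\mu)-\Phi(\mu_0)]}{(\mu-\mu_0)^\zeta},$$ whenever this limit exists and is finite; here $\Gamma$ is the Gamma function. For $\mu<\mu_0$, the power $(\mu-\mu_0)^\zeta$ is understood by any one fixed convention for the $\zeta$-th power of a negative number that satisfies $|t^\zeta|=|t|^\zeta$. "$D^{(\zeta)}\Phi$ exists on $(a,b)$" means that this derivative exists at every point of $(a,b)$; in particular such a $\Phi$ is continuous on $(a,b)$. The second iterate is denoted $D^{(2\zeta)}\psi=D^{(\zeta)}\bigl(D^{(\zeta)}\psi\bigr)$. *)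

theory Defs
  imports "HOL-Analysis.Analysis"
begin

text \<open>
  A function \<open>pw\<close> is an admissible reading of \<open>t \<mapsto> t\<^sup>\<zeta>\<close> if it is the usual power for
  positive \<open>t\<close> and has the right absolute value for negative \<open>t\<close>; its sign or phase there
  is left open. The value at \<open>0\<close> never enters a punctured limit and is unconstrained.
\<close>

definition power_convention :: "real \<Rightarrow> (real \<Rightarrow> 'a::real_normed_field) \<Rightarrow> bool" where
  "power_convention \<zeta> pw \<longleftrightarrow>
     (\<forall>t>0. pw t = of_real (t powr \<zeta>)) \<and> (\<forall>t<0. norm (pw t) = \<bar>t\<bar> powr \<zeta>)"

definition lf_quotient ::
  "(real \<Rightarrow> 'a::real_normed_field) \<Rightarrow> real \<Rightarrow> (real \<Rightarrow> 'a) \<Rightarrow> real \<Rightarrow> real \<Rightarrow> 'a" where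
  "lf_quotient pw \<zeta> f \<mu>0 \<mu> = of_real (Gamma (1 + \<zeta>)) * (f \<mu> - f \<mu>0) / pw (\<mu> - \<mu>0)"

definition lf_differentiable ::
  "(real \<Rightarrow> 'a::real_normed_field) \<Rightarrow> real \<Rightarrow> (real \<Rightarrow> 'a) \<Rightarrow> real \<Rightarrow> bool" where
  "lf_differentiable pw \<zeta> f \<mu>0 \<longleftrightarrow> (\<exists>L. (lf_quotient pw \<zeta> f \<mu>0 \<longlongrightarrow> L) (at \<mu>0))"

text \<open>Meaningful only where \<open>lf_differentiable\<close> holds; unspecified elsewhere.\<close>

definition lf_deriv ::
  "(real \<Rightarrow> 'a::real_normed_field) \<Rightarrow> real \<Rightarrow> (real \<Rightarrow> 'a) \<Rightarrow> real \<Rightarrow> 'a" where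
  "lf_deriv pw \<zeta> f \<mu>0 = Lim (at \<mu>0) (lf_quotient pw \<zeta> f \<mu>0)"

end

theory Submission
  imports Defs
begin

text \<open>
  The local fractional derivative obeys the classical product and quotient rules. The algebra of
  the difference quotients is the usual one, because the common denominator
  \<open>(\<mu> - \<mu>\<^sub>0)\<^sup>\<zeta>\<close> is carried along unchanged; the only analytic input is that a function with a
  finite local fractional derivative is continuous (\<open>lf_tendsto_imp_continuous\<close>), and for
  that it suffices that the absolute value \<open>\<bar>\<mu> - \<mu>\<^sub>0\<bar>\<^sup>\<zeta>\<close> of the denominator tends to \<open>0\<close>,
  which every admissible reading of the power guarantees.

  Writing a prime for the local fractional derivative, the quotient rule therefore applies to
  \<open>\<Phi> = - \<psi>' / (w\<^sub>2 \<psi>)\<close> and gives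
  \<open>\<Phi>' = - \<psi>'' / (w\<^sub>2 \<psi>) + \<psi>' w\<^sub>2' / (w\<^sub>2\<^sup>2 \<psi>) + \<psi>'\<^sup>2 / (w\<^sub>2 \<psi>\<^sup>2)\<close>.
  The last term equals \<open>w\<^sub>2 \<Phi>\<^sup>2\<close>, so the quadratic term of the Riccati equation cancels. What is
  left is, after multiplication by the nonzero factor \<open>- w\<^sub>2 \<psi>\<close>, the linear equation. The two
  equations are thus equivalent at each single point of the interval.
\<close>

lemma lf_tendsto_imp_differentiable:
  assumes "(lf_quotient pw \<zeta> f m \<longlongrightarrow> L) (at m)"
  shows "lf_differentiable pw \<zeta> f m" and "lf_deriv pw \<zeta> f m = L"
  using assms by (auto simp: lf_differentiable_def lf_deriv_def intro!: tendsto_Lim)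

lemma lf_differentiable_imp_tendsto:
  assumes "lf_differentiable pw \<zeta> f m"
  shows "(lf_quotient pw \<zeta> f m \<longlongrightarrow> lf_deriv pw \<zeta> f m) (at m)"
  using assms lf_tendsto_imp_differentiable(2) unfolding lf_differentiable_def by metis

lemma norm_power_convention:
  assumes "power_convention \<zeta> pw" and "t \<noteq> 0"
  shows "norm (pw t) = \<bar>t\<bar> powr \<zeta>"
  using assms by (cases "t > 0") (auto simp: power_convention_def)

text \<open>
  Up to the constant \<open>\<Gamma>(1 + \<zeta>)\<close>, the increment of \<open>f\<close> is the convergent quotient times the power,
  and the power tends to \<open>0\<close>.
\<close>

lemma lf_tendsto_imp_continuous:
  assumes "0 < \<zeta>" and pw: "power_convention \<zeta> pw"
    and lim: "(lf_quotient pw \<zeta> f m \<longlongrightarrow> L) (at m)"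
  shows "(f \<longlongrightarrow> f m) (at m)"
proof -
  have Gamma_nz: "Gamma (1 + \<zeta>) \<noteq> 0"
    using \<open>0 < \<zeta>\<close> Gamma_real_pos[of "1 + \<zeta>"] by linarith
  have "((\<lambda>x. \<bar>x - m\<bar> powr \<zeta>) \<longlongrightarrow> \<bar>m - m\<bar> powr \<zeta>) (at m)"
    using \<open>0 < \<zeta>\<close> by (intro tendsto_powr' tendsto_intros) auto
  then have "((\<lambda>x. \<bar>x - m\<bar> powr \<zeta>) \<longlongrightarrow> 0) (at m)"
    by simp
  moreover have "\<forall>\<^sub>F x in at m. \<bar>x - m\<bar> powr \<zeta> = norm (pw (x - m))"
    using norm_power_convention[OF pw] by (auto simp: eventually_at_filter)
  ultimately have "((\<lambda>x. norm (pw (x - m))) \<longlongrightarrow> 0) (at m)"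
    by (rule Lim_transform_eventually)
  then have "((\<lambda>x. pw (x - m)) \<longlongrightarrow> 0) (at m)"
    by (rule tendsto_norm_zero_cancel)
  then have *: "((\<lambda>x. f m + lf_quotient pw \<zeta> f m x * pw (x - m) / of_real (Gamma (1 + \<zeta>)))
      \<longlongrightarrow> f m + L * 0 / of_real (Gamma (1 + \<zeta>))) (at m)"
    using Gamma_nz by (intro tendsto_intros lim) auto
  have "f m + lf_quotient pw \<zeta> f m x * pw (x - m) / of_real (Gamma (1 + \<zeta>)) = f x"
    if "x \<noteq> m" for x
  proof -
    have "pw (x - m) \<noteq> 0"
      using norm_power_convention[OF pw, of "x - m"] that by auto
    then show ?thesis
      using Gamma_nz by (simp add: lf_quotient_def)
  qed
  then have "\<forall>\<^sub>F x in at m.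
      f m + lf_quotient pw \<zeta> f m x * pw (x - m) / of_real (Gamma (1 + \<zeta>)) = f x"
    by (simp add: eventually_at_filter)
  from Lim_transform_eventually[OF * this] show ?thesis
    by simp
qed

lemma lf_quotient_minus:
  "lf_quotient pw \<zeta> (\<lambda>x. - f x) m = (\<lambda>x. - lf_quotient pw \<zeta> f m x)"
  by (rule ext, simp add: lf_quotient_def minus_divide_left right_diff_distrib)

lemma lf_tendsto_mult:
  assumes "0 < \<zeta>" and "power_convention \<zeta> pw"
    and f: "(lf_quotient pw \<zeta> f m \<longlongrightarrow> F) (at m)"
    and g: "(lf_quotient pw \<zeta> g m \<longlongrightarrow> G) (at m)"
  shows "(lf_quotient pw \<zeta> (\<lambda>x. f x * g x) m \<longlongrightarrow> F * g m + f m * G) (at m)"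
proof -
  have "((\<lambda>x. lf_quotient pw \<zeta> f m x * g x + f m * lf_quotient pw \<zeta> g m x)
      \<longlongrightarrow> F * g m + f m * G) (at m)"
    using lf_tendsto_imp_continuous[OF assms(1,2) g] by (intro tendsto_intros f g)
  moreover have "lf_quotient pw \<zeta> (\<lambda>x. f x * g x) m =
      (\<lambda>x. lf_quotient pw \<zeta> f m x * g x + f m * lf_quotient pw \<zeta> g m x)"
    by (rule ext, simp add: lf_quotient_def algebra_simps flip: add_divide_distrib)
  ultimately show ?thesis
    by simp
qed

lemma lf_tendsto_divide:
  assumes "0 < \<zeta>" and "power_convention \<zeta> pw"
    and f: "(lf_quotient pw \<zeta> f m \<longlongrightarrow> F) (at m)"
    and g: "(lf_quotient pw \<zeta> g m \<longlongrightarrow> G) (at m)"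
    and "g m \<noteq> 0"
  shows "(lf_quotient pw \<zeta> (\<lambda>x. f x / g x) m \<longlongrightarrow> (F * g m - f m * G) / (g m)\<^sup>2) (at m)"
proof -
  have cont: "(g \<longlongrightarrow> g m) (at m)"
    by (rule lf_tendsto_imp_continuous[OF assms(1,2) g])
  have "((\<lambda>x. (lf_quotient pw \<zeta> f m x * g m - f m * lf_quotient pw \<zeta> g m x) / (g x * g m))
      \<longlongrightarrow> (F * g m - f m * G) / (g m * g m)) (at m)"
    using \<open>g m \<noteq> 0\<close> by (intro tendsto_intros f g cont) auto
  moreover have "\<forall>\<^sub>F x in at m.
      (lf_quotient pw \<zeta> f m x * g m - f m * lf_quotient pw \<zeta> g m x) / (g x * g m) =
      lf_quotient pw \<zeta> (\<lambda>x. f x / g x) m x"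
    using tendsto_imp_eventually_ne[OF cont \<open>g m \<noteq> 0\<close>]
  proof eventually_elim
    case (elim x)
    show ?case
      by (cases "pw (x - m) = 0")
         (use elim \<open>g m \<noteq> 0\<close> in \<open>simp_all add: lf_quotient_def field_simps\<close>)
  qed
  ultimately show ?thesis
    unfolding power2_eq_square by (rule Lim_transform_eventually)
qed

text \<open>
  Needed because \<open>\<Phi> = - \<psi>' / (w\<^sub>2 \<psi>)\<close> holds on the interval only, not as an identity of
  functions on the whole line.
\<close>

lemma lf_tendsto_cong_open:
  assumes "open S" and "m \<in> S" and eq: "\<And>x. x \<in> S \<Longrightarrow> f x = g x"
    and lim: "(lf_quotient pw \<zeta> g m \<longlongrightarrow> L) (at m)"
  shows "(lf_quotient pw \<zeta> f m \<longlongrightarrow> L) (at m)"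
proof -
  have "\<forall>\<^sub>F x in at m. x \<in> S"
    using assms(1,2) by (rule eventually_at_in_open')
  then have "\<forall>\<^sub>F x in at m. lf_quotient pw \<zeta> g m x = lf_quotient pw \<zeta> f m x"
    by eventually_elim (simp add: lf_quotient_def eq \<open>m \<in> S\<close>)
  with lim show ?thesis
    by (rule Lim_transform_eventually)
qed

text \<open>
  The pointwise equivalence, with \<open>p\<close>, \<open>p1\<close>, \<open>p2\<close> for the values of \<open>\<psi>\<close> and its first two
  derivatives, and \<open>w\<close>, \<open>w'\<close> for those of \<open>w\<^sub>2\<close> and its derivative: the left-hand side of the
  linear equation is \<open>- w p\<close> times the difference of the two sides of the Riccati equation.
\<close>

lemma riccati_iff_linear_pointwise:
  fixes w w' w0 w1 p p1 p2 :: "'a::field"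
  assumes "w \<noteq> 0" and "p \<noteq> 0"
  shows "((- p2) * (w * p) - (- p1) * (w' * p + w * p1)) / (w * p)\<^sup>2
           = w0 + w1 * (- (p1 / (w * p))) + w * (- (p1 / (w * p)))\<^sup>2
         \<longleftrightarrow> p2 - (w1 + w' / w) * p1 + (w * w0) * p = 0"
    (is "?l = ?r \<longleftrightarrow> ?lin = 0")
proof -
  have "?l = - (p2 / (w * p)) + p1 * w' / (w\<^sup>2 * p) + w * (p1 / (w * p))\<^sup>2"
    using assms by (simp add: divide_simps) (simp add: algebra_simps power2_eq_square)
  then have "?l - ?r = - (p2 / (w * p)) + p1 * w' / (w\<^sup>2 * p) - w0 + w1 * (p1 / (w * p))"
    by simp
  also have "\<dots> = - ?lin / (w * p)"
    using assms by (simp add: divide_simps) (simp add: algebra_simps power2_eq_square)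
  finally have "?l - ?r = - ?lin / (w * p)" .
  moreover have "- ?lin / (w * p) = 0 \<longleftrightarrow> ?lin = 0"
    using assms by (simp only: divide_eq_0_iff neg_equal_0_iff_equal mult_eq_0_iff) simp
  ultimately show ?thesis
    by (metis eq_iff_diff_eq_0)
qed

theorem mainTheorem1:
  fixes \<zeta> a b :: real
    and pw :: "real \<Rightarrow> 'a::real_normed_field"
    and w0 w1 w2 \<Omega>1 \<Omega>2 \<psi> \<Phi> :: "real \<Rightarrow> 'a"
  assumes "0 < \<zeta>" and "\<zeta> \<le> 1"
    and "a < b"
    and "power_convention \<zeta> pw"
    and "\<forall>\<mu>\<in>{a<..<b}. w0 \<mu> \<noteq> 0"
    and "\<forall>\<mu>\<in>{a<..<b}. w2 \<mu> \<noteq> 0"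
    and "\<forall>\<mu>\<in>{a<..<b}. lf_differentiable pw \<zeta> w2 \<mu>"
    and "\<forall>\<mu>\<in>{a<..<b}. \<Omega>1 \<mu> = w2 \<mu> * w0 \<mu>"
    and "\<forall>\<mu>\<in>{a<..<b}. \<Omega>2 \<mu> = w1 \<mu> + lf_deriv pw \<zeta> w2 \<mu> / w2 \<mu>"
    and "\<forall>\<mu>\<in>{a<..<b}. \<psi> \<mu> \<noteq> 0"
    and "\<forall>\<mu>\<in>{a<..<b}. lf_differentiable pw \<zeta> \<psi> \<mu>"
    and "\<forall>\<mu>\<in>{a<..<b}. lf_differentiable pw \<zeta> (lf_deriv pw \<zeta> \<psi>) \<mu>"
    and "\<forall>\<mu>\<in>{a<..<b}. \<Phi> \<mu> = - (lf_deriv pw \<zeta> \<psi> \<mu> / (w2 \<mu> * \<psi> \<mu>))"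
  shows "(\<forall>\<mu>\<in>{a<..<b}. lf_differentiable pw \<zeta> \<Phi> \<mu> \<and>
            lf_deriv pw \<zeta> \<Phi> \<mu> = w0 \<mu> + w1 \<mu> * \<Phi> \<mu> + w2 \<mu> * (\<Phi> \<mu>)\<^sup>2)
     \<longleftrightarrow> (\<forall>\<mu>\<in>{a<..<b}.
            lf_deriv pw \<zeta> (lf_deriv pw \<zeta> \<psi>) \<mu> - \<Omega>2 \<mu> * lf_deriv pw \<zeta> \<psi> \<mu> + \<Omega>1 \<mu> * \<psi> \<mu> = 0)"
proof (rule ball_cong[OF refl])
  fix m assume m: "m \<in> {a<..<b}"
  let ?D = "lf_deriv pw \<zeta>"
  note limit = lf_differentiable_imp_tendsto
  have "w2 m * \<psi> m \<noteq> 0"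
    using assms m by simp
  have num: "(lf_quotient pw \<zeta> (\<lambda>x. - ?D \<psi> x) m \<longlongrightarrow> - ?D (?D \<psi>) m) (at m)"
  proof -
    have "(lf_quotient pw \<zeta> (?D \<psi>) m \<longlongrightarrow> ?D (?D \<psi>) m) (at m)"
      using assms m by (intro limit) auto
    from tendsto_minus[OF this] show ?thesis
      by (simp only: lf_quotient_minus)
  qed
  have den: "(lf_quotient pw \<zeta> (\<lambda>x. w2 x * \<psi> x) m \<longlongrightarrow> ?D w2 m * \<psi> m + w2 m * ?D \<psi> m) (at m)"
    using assms m by (intro lf_tendsto_mult limit) auto
  have "(lf_quotient pw \<zeta> \<Phi> m \<longlongrightarrow>
      ((- ?D (?D \<psi>) m) * (w2 m * \<psi> m) - (- ?D \<psi> m) * (?D w2 m * \<psi> m + w2 m * ?D \<psi> m))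
        / (w2 m * \<psi> m)\<^sup>2) (at m)"
    by (rule lf_tendsto_cong_open[OF open_greaterThanLessThan m _
          lf_tendsto_divide[OF assms(1,4) num den \<open>w2 m * \<psi> m \<noteq> 0\<close>]])
       (use assms in simp)
  note \<Phi> = lf_tendsto_imp_differentiable[OF this]
  have "w2 m \<noteq> 0" and "\<psi> m \<noteq> 0"
    using assms m by auto
  note riccati_iff_linear_pointwise[OF this, of "?D (?D \<psi>) m" "?D \<psi> m" "?D w2 m" "w0 m" "w1 m"]
  moreover have "\<Phi> m = - (?D \<psi> m / (w2 m * \<psi> m))"
      and "\<Omega>1 m = w2 m * w0 m" and "\<Omega>2 m = w1 m + ?D w2 m / w2 m"
    using assms m by auto
  ultimately show "lf_differentiable pw \<zeta> \<Phi> m \<and>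
        ?D \<Phi> m = w0 m + w1 m * \<Phi> m + w2 m * (\<Phi> m)\<^sup>2
      \<longleftrightarrow> ?D (?D \<psi>) m - \<Omega>2 m * ?D \<psi> m + \<Omega>1 m * \<psi> m = 0"
    using \<Phi> by simp
qed

end
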